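(* Let $G$ be a signed digraph. If $G$ has at most one negative cycle, then $G$ is separating. If $G$ is strongly connected and has at most one negative cycle, then $G$ is trapping.
   Context: A signed digraph $G=(V,E)$ has finite vertex set $V$ and arcs $E\subseteq V\times V\times\{-1,1\}$ ($(j,i,s)$: arc from $j$ to $i$ of sign $s$; loops and opposite-sign parallel arcs allowed). Cycles are simple subgraphs; sign = product of arc signs. Strong connectivity refers to the underlying unsigned digraph. A BN on $V$ is a map $f:\{0,1\}^V\to\{0,1\}^V$; $G(f)$ has a positive (negative) arc from $j$ to $i$ iff for some $x$ with $x_j=0$, $f_i(x+e_j)-f_i(x)$ is positive (negative) ($e_j$ = configuration equal to $1$ only at $j$, $+$ mod 2). $F(G)=\{f:G(f)=G\}$. $\Gamma(f)$ is the digraph on $\{0,1\}^V$ with arcs $x\to x+e_i$ whenever $f_i(x)\neq x_i$. A trap set has no outgoing arc; an attractor is an inclusion-minimal nonempty trap set. A subspace is $\{x: x_i=c(i)\ \forall i\in I\}$; $[X]$ is the smallest subspace containing $X$; a trap space is a subspace that is a trap set; $\langle X\rangle$ is the smallest trap space containing $X$. $\Gamma(f)$ is separating if $[A]\cap[B]=\emptyset$ for all distinct attractors $A,B$, and trapping if it is separating and $[A]=\langle A\rangle$ for every attractor $A$. $G$ is separating (trapping) if $\Gamma(f)$ is separating (trapping) for all $f\in F(G)$. *)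

theory Defs
  imports Main "HOL-Library.FuncSet"
begin

text \<open>An arc \<open>(j, i, s)\<close> goes from \<open>j\<close> to \<open>i\<close> and has sign \<open>s\<close>.\<close>

type_synonym 'a arc = "'a \<times> 'a \<times> int"

definition signed_digraph :: "'a set \<Rightarrow> 'a arc set \<Rightarrow> bool" where
  "signed_digraph V E \<longleftrightarrow> finite V \<and> E \<subseteq> V \<times> V \<times> {-1, 1}"

definition arc_tail :: "'a arc \<Rightarrow> 'a" where
  "arc_tail a = fst a"

definition arc_head :: "'a arc \<Rightarrow> 'a" where
  "arc_head a = fst (snd a)"

definition arc_sign :: "'a arc \<Rightarrow> int" where
  "arc_sign a = snd (snd a)"

definition strongly_connected :: "'a set \<Rightarrow> 'a arc set \<Rightarrow> bool" where
  "strongly_connected V E \<longleftrightarrow>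
     (\<forall>u\<in>V. \<forall>v\<in>V. (u, v) \<in> {(arc_tail a, arc_head a) | a. a \<in> E}\<^sup>*)"

text \<open>A cycle is a subgraph, so it is represented by its set of arcs (which determines its
  vertices): rotating the list \<open>as\<close> does not give a new cycle, whereas replacing an arc
  by the parallel arc of opposite sign does. Loops are cycles of length one.\<close>

definition is_cycle :: "'a arc set \<Rightarrow> 'a arc set \<Rightarrow> bool" where
  "is_cycle E C \<longleftrightarrow> C \<subseteq> E \<and>
     (\<exists>as. as \<noteq> [] \<and> set as = C \<and> distinct (map arc_tail as) \<and>
       (\<forall>k < length as. arc_head (as ! k) = arc_tail (as ! (Suc k mod length as))))"

definition cycle_sign :: "'a arc set \<Rightarrow> int" where
  "cycle_sign C = (\<Prod>a\<in>C. arc_sign a)"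

definition negative_cycle :: "'a arc set \<Rightarrow> 'a arc set \<Rightarrow> bool" where
  "negative_cycle E C \<longleftrightarrow> is_cycle E C \<and> cycle_sign C = -1"


type_synonym 'a config = "'a \<Rightarrow> bool"

text \<open>The configurations \<open>{0,1}\<^sup>V\<close>; the extensional function space makes a configuration
  depend only on its values on \<open>V\<close>.\<close>

definition configs :: "'a set \<Rightarrow> 'a config set" where
  "configs V = (V \<rightarrow>\<^sub>E (UNIV :: bool set))"

text \<open>\<open>flip x i\<close> is \<open>x + e\<^sub>i\<close>, with addition modulo 2.\<close>

definition flip :: "'a config \<Rightarrow> 'a \<Rightarrow> 'a config" where
  "flip x i = x(i := \<not> x i)"

text \<open>The variation \<open>f\<^sub>i(x + e\<^sub>j) - f\<^sub>i(x)\<close>.\<close>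

definition variation :: "('a config \<Rightarrow> 'a config) \<Rightarrow> 'a \<Rightarrow> 'a \<Rightarrow> 'a config \<Rightarrow> int" where
  "variation f j i x = of_bool (f (flip x j) i) - of_bool (f x i)"

definition interaction_arcs :: "'a set \<Rightarrow> ('a config \<Rightarrow> 'a config) \<Rightarrow> 'a arc set" where
  "interaction_arcs V f =
     {(j, i, 1) | j i. j \<in> V \<and> i \<in> V \<and> (\<exists>x\<in>configs V. \<not> x j \<and> variation f j i x > 0)} \<union>
     {(j, i, -1) | j i. j \<in> V \<and> i \<in> V \<and> (\<exists>x\<in>configs V. \<not> x j \<and> variation f j i x < 0)}"

text \<open>\<open>F(G)\<close>. Values of \<open>f\<close> outside \<open>configs V\<close> are left unconstrained; no notion below
  depends on them.\<close>

definition networks_on :: "'a set \<Rightarrow> 'a arc set \<Rightarrow> ('a config \<Rightarrow> 'a config) set" where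
  "networks_on V E = {f \<in> configs V \<rightarrow> configs V. interaction_arcs V f = E}"

text \<open>The asynchronous graph \<open>\<Gamma>(f)\<close>, as its set of arcs on \<open>configs V\<close>.\<close>

definition async_graph :: "'a set \<Rightarrow> ('a config \<Rightarrow> 'a config) \<Rightarrow> 'a config rel" where
  "async_graph V f = {(x, flip x i) | x i. x \<in> configs V \<and> i \<in> V \<and> f x i \<noteq> x i}"

definition trap_set :: "'a set \<Rightarrow> 'a config rel \<Rightarrow> 'a config set \<Rightarrow> bool" where
  "trap_set V \<Gamma> T \<longleftrightarrow> T \<subseteq> configs V \<and> (\<forall>(x, y)\<in>\<Gamma>. x \<in> T \<longrightarrow> y \<in> T)"

definition attractor :: "'a set \<Rightarrow> 'a config rel \<Rightarrow> 'a config set \<Rightarrow> bool" where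
  "attractor V \<Gamma> A \<longleftrightarrow> A \<noteq> {} \<and> trap_set V \<Gamma> A \<and>
     (\<forall>T. T \<noteq> {} \<and> trap_set V \<Gamma> T \<and> T \<subseteq> A \<longrightarrow> T = A)"

definition config_subspace :: "'a set \<Rightarrow> 'a config set \<Rightarrow> bool" where
  "config_subspace V S \<longleftrightarrow> (\<exists>I c. I \<subseteq> V \<and> S = {x \<in> configs V. \<forall>i\<in>I. x i = c i})"

definition trap_space :: "'a set \<Rightarrow> 'a config rel \<Rightarrow> 'a config set \<Rightarrow> bool" where
  "trap_space V \<Gamma> S \<longleftrightarrow> config_subspace V S \<and> trap_set V \<Gamma> S"

text \<open>\<open>[X]\<close> and \<open>\<langle>X\<rangle>\<close>. Both are well defined for nonempty \<open>X \<subseteq> configs V\<close>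
  (lemmas \<open>smallest_subspace\<close> and \<open>smallest_trap_space\<close> below), in particular for attractors.\<close>

definition subspace_hull :: "'a set \<Rightarrow> 'a config set \<Rightarrow> 'a config set" where
  "subspace_hull V X = (LEAST S. config_subspace V S \<and> X \<subseteq> S)"

definition trap_space_hull :: "'a set \<Rightarrow> 'a config rel \<Rightarrow> 'a config set \<Rightarrow> 'a config set" where
  "trap_space_hull V \<Gamma> X = (LEAST S. trap_space V \<Gamma> S \<and> X \<subseteq> S)"

definition separating_graph :: "'a set \<Rightarrow> 'a config rel \<Rightarrow> bool" where
  "separating_graph V \<Gamma> \<longleftrightarrow>
     (\<forall>A B. attractor V \<Gamma> A \<and> attractor V \<Gamma> B \<and> A \<noteq> B \<longrightarrow>
        subspace_hull V A \<inter> subspace_hull V B = {})"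

definition trapping_graph :: "'a set \<Rightarrow> 'a config rel \<Rightarrow> bool" where
  "trapping_graph V \<Gamma> \<longleftrightarrow> separating_graph V \<Gamma> \<and>
     (\<forall>A. attractor V \<Gamma> A \<longrightarrow> subspace_hull V A = trap_space_hull V \<Gamma> A)"

definition separating :: "'a set \<Rightarrow> 'a arc set \<Rightarrow> bool" where
  "separating V E \<longleftrightarrow> (\<forall>f\<in>networks_on V E. separating_graph V (async_graph V f))"

definition trapping :: "'a set \<Rightarrow> 'a arc set \<Rightarrow> bool" where
  "trapping V E \<longleftrightarrow> (\<forall>f\<in>networks_on V E. trapping_graph V (async_graph V f))"


lemma subspace_Inter:
  assumes sub: "\<And>S. S \<in> \<S> \<Longrightarrow> config_subspace V S"
    and a: "a \<in> \<Inter>\<S>" and ne: "\<S> \<noteq> {}"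
  shows "config_subspace V (\<Inter>\<S>)"
proof -
  define fixed where "fixed S = {i \<in> V. \<forall>x\<in>S. x i = a i}" for S
  have S_eq: "S = {x \<in> configs V. \<forall>i\<in>fixed S. x i = a i}" if S_in: "S \<in> \<S>" for S
  proof -
    obtain I c where I: "I \<subseteq> V" and S: "S = {x \<in> configs V. \<forall>i\<in>I. x i = c i}"
      using sub[OF S_in] unfolding config_subspace_def by blast
    have "a \<in> S" using a S_in by blast
    then have c: "c i = a i" if "i \<in> I" for i using S that by auto
    have "I \<subseteq> fixed S"
    proof
      fix i assume "i \<in> I"
      then show "i \<in> fixed S" using I S c by (auto simp: fixed_def)
    qed
    moreover have "x \<in> configs V" "\<forall>i\<in>fixed S. x i = a i" if "x \<in> S" for x
      using that S by (auto simp: fixed_def)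
    moreover have "x \<in> S" if "x \<in> configs V" "\<forall>i\<in>I. x i = a i" for x
      using that S c by auto
    ultimately show ?thesis by blast
  qed
  have "x \<in> \<Inter>\<S> \<longleftrightarrow> x \<in> configs V \<and> (\<forall>i\<in>\<Union>(fixed ` \<S>). x i = a i)" for x
  proof -
    have "x \<in> S \<longleftrightarrow> x \<in> configs V \<and> (\<forall>i\<in>fixed S. x i = a i)" if "S \<in> \<S>" for S
      by (subst S_eq[OF that]) simp
    then show ?thesis using ne by auto
  qed
  then have "\<Inter>\<S> = {x \<in> configs V. \<forall>i\<in>\<Union>(fixed ` \<S>). x i = a i}"
    by (intro set_eqI) (simp only: mem_Collect_eq)
  moreover have "\<Union>(fixed ` \<S>) \<subseteq> V" by (auto simp: fixed_def)
  ultimately show ?thesis unfolding config_subspace_def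
    by (intro exI[of _ "\<Union>(fixed ` \<S>)"] exI[of _ a] conjI)
qed

lemma subspace_configs: "config_subspace V (configs V)"
  unfolding config_subspace_def by (rule exI[of _ "{}"]) auto

lemma smallest_subspace:
  assumes "X \<noteq> {}" "X \<subseteq> configs V"
  shows "config_subspace V (subspace_hull V X)" "X \<subseteq> subspace_hull V X"
    and "\<And>S. config_subspace V S \<Longrightarrow> X \<subseteq> S \<Longrightarrow> subspace_hull V X \<subseteq> S"
proof -
  let ?\<S> = "{S. config_subspace V S \<and> X \<subseteq> S}"
  obtain a where "a \<in> X" using assms by blast
  moreover have "?\<S> \<noteq> {}" using subspace_configs assms by blast
  ultimately have sub: "config_subspace V (\<Inter>?\<S>)" by (intro subspace_Inter[of _ _ a]) auto
  have eq: "subspace_hull V X = \<Inter>?\<S>"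
    unfolding subspace_hull_def by (rule Least_equality) (use sub in blast)+
  show "config_subspace V (subspace_hull V X)" "X \<subseteq> subspace_hull V X"
    and "\<And>S. config_subspace V S \<Longrightarrow> X \<subseteq> S \<Longrightarrow> subspace_hull V X \<subseteq> S"
    using sub unfolding eq by blast+
qed

lemma smallest_trap_space:
  assumes "X \<noteq> {}" "X \<subseteq> configs V" "\<Gamma> \<subseteq> configs V \<times> configs V"
  shows "trap_space V \<Gamma> (trap_space_hull V \<Gamma> X)" "X \<subseteq> trap_space_hull V \<Gamma> X"
    and "\<And>S. trap_space V \<Gamma> S \<Longrightarrow> X \<subseteq> S \<Longrightarrow> trap_space_hull V \<Gamma> X \<subseteq> S"
proof -
  let ?\<S> = "{S. trap_space V \<Gamma> S \<and> X \<subseteq> S}"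
  obtain a where "a \<in> X" using assms by blast
  moreover have mem: "configs V \<in> ?\<S>"
    using subspace_configs assms by (auto simp: trap_space_def trap_set_def)
  ultimately have "config_subspace V (\<Inter>?\<S>)"
    by (intro subspace_Inter[of _ _ a]) (auto simp: trap_space_def)
  moreover have "\<Inter>?\<S> \<subseteq> configs V" using mem by blast
  moreover have "\<forall>(x, y)\<in>\<Gamma>. x \<in> \<Inter>?\<S> \<longrightarrow> y \<in> \<Inter>?\<S>"
    by (auto simp: trap_space_def trap_set_def)
  ultimately have sub: "trap_space V \<Gamma> (\<Inter>?\<S>)" by (simp add: trap_space_def trap_set_def)
  have eq: "trap_space_hull V \<Gamma> X = \<Inter>?\<S>"
    unfolding trap_space_hull_def by (rule Least_equality) (use sub in blast)+
  show "trap_space V \<Gamma> (trap_space_hull V \<Gamma> X)" "X \<subseteq> trap_space_hull V \<Gamma> X"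
    and "\<And>S. trap_space V \<Gamma> S \<Longrightarrow> X \<subseteq> S \<Longrightarrow> trap_space_hull V \<Gamma> X \<subseteq> S"
    using sub unfolding eq by blast+
qed

end

theory Submission
  imports Defs
begin

text \<open>A strong signed digraph with at most one negative cycle becomes all-positive, after a switch
  of signs \<open>\<sigma>\<close>, once the arcs entering some vertex \<open>j\<close> are ignored. Hence every local function but
  \<open>f\<^sub>j\<close> is monotone for the order with top \<open>\<sigma>\<close>, and each attractor contains a largest and a smallest
  configuration of its subspace hull: a largest element, taken among those with the largest value
  at \<open>j\<close>, bounds a trap set. Sandwiching a point of the hull between the two shows that the hull is
  a trap space. For separation, the strong components are treated one after the other. Suppose
  that two attractors whose hulls share a point \<open>x\<close> project identically to the preceding
  components \<open>P\<close>. An attractor is closed under exchanging \<open>P\<close>-parts, because \<open>P\<close> evolves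
  autonomously, so on the next component the smallest configuration of each attractor is below
  \<open>x\<close>, hence below the largest of the other, and the largest ones coincide.\<close>

section \<open>Signed walks\<close>

inductive walk :: "'a arc set \<Rightarrow> 'a \<Rightarrow> 'a \<Rightarrow> int \<Rightarrow> bool" for A where
  walk_refl: "walk A u u 1"
| walk_step: "walk A u v s \<Longrightarrow> (v, w, r) \<in> A \<Longrightarrow> walk A u w (s * r)"

lemma walk_arc: "(u, v, r) \<in> A \<Longrightarrow> walk A u v r"
  using walk_step[OF walk_refl, of u v r A] by simp

lemma walk_trans: "walk A v w r \<Longrightarrow> walk A u v s \<Longrightarrow> walk A u w (s * r)"
proof (induction rule: walk.induct)
  case (walk_step v w r x q)
  then show ?case using walk.walk_step[of A u w "s * r" x q] by (simp add: mult.assoc)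
qed simp

lemma walk_mono: "walk A u v s \<Longrightarrow> A \<subseteq> B \<Longrightarrow> walk B u v s"
  by (induction rule: walk.induct) (auto intro: walk.intros)

lemma walk_sign:
  assumes "walk A u v s" "A \<subseteq> UNIV \<times> UNIV \<times> {-1, 1}"
  shows "s = 1 \<or> s = -1"
  using assms by (induction rule: walk.induct) auto

text \<open>Cutting at the first use of the arc leaves a prefix that avoids it; the remainder may
  use it again. \<open>walk_split_last\<close> is the mirror image, with the avoiding piece at the
  end.\<close>

lemma walk_split_first:
  assumes "walk A u v s"
  shows "walk (A - {(p, q, r)}) u v s \<or>
    (\<exists>s1 s2. walk (A - {(p, q, r)}) u p s1 \<and> walk A q v s2 \<and> s = s1 * r * s2)"
  using assms
proof (induction rule: walk.induct)
  case (walk_refl u)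
  show ?case by (blast intro: walk.walk_refl)
next
  case (walk_step u v s w r')
  from walk_step.IH show ?case
  proof
    assume W: "walk (A - {(p, q, r)}) u v s"
    show ?thesis
    proof (cases "(v, w, r') = (p, q, r)")
      case True
      then show ?thesis using W walk.walk_refl[of A q] by force
    next
      case False
      then show ?thesis using walk.walk_step[OF W] walk_step.hyps by blast
    qed
  next
    assume "\<exists>s1 s2. walk (A - {(p, q, r)}) u p s1 \<and> walk A q v s2 \<and> s = s1 * r * s2"
    then obtain s1 s2 where "walk (A - {(p, q, r)}) u p s1" "walk A q v s2" "s = s1 * r * s2"
      by blast
    moreover from this have "walk A q w (s2 * r')" using walk_step.hyps(2) by (blast intro: walk.walk_step)
    ultimately show ?thesis by (metis mult.assoc)
  qed
qed

lemma walk_split_last: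
  assumes "walk A u v s"
  shows "walk (A - {(p, q, r)}) u v s \<or>
    (\<exists>s1 s2. walk A u p s1 \<and> walk (A - {(p, q, r)}) q v s2 \<and> s = s1 * r * s2)"
  using assms
proof (induction rule: walk.induct)
  case (walk_refl u)
  show ?case by (blast intro: walk.walk_refl)
next
  case (walk_step u v s w r')
  show ?case
  proof (cases "(v, w, r') = (p, q, r)")
    case True
    then show ?thesis using walk_step.hyps walk.walk_refl[of "A - {(p, q, r)}" q] by force
  next
    case False
    then have arc: "(v, w, r') \<in> A - {(p, q, r)}" using walk_step.hyps by blast
    from walk_step.IH show ?thesis
    proof
      assume "walk (A - {(p, q, r)}) u v s"
      then show ?thesis using arc by (blast intro: walk.walk_step)
    next
      assume "\<exists>s1 s2. walk A u p s1 \<and> walk (A - {(p, q, r)}) q v s2 \<and> s = s1 * r * s2"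
      then obtain s1 s2 where "walk A u p s1" "walk (A - {(p, q, r)}) q v s2" "s = s1 * r * s2"
        by blast
      moreover from this have "walk (A - {(p, q, r)}) q w (s2 * r')"
        using arc by (blast intro: walk.walk_step)
      ultimately show ?thesis by (metis mult.assoc)
    qed
  qed
qed

section \<open>Arc lists: from closed walks to negative cycles and back\<close>

fun chain :: "'a \<Rightarrow> 'a arc list \<Rightarrow> 'a \<Rightarrow> bool" where
  "chain u [] v \<longleftrightarrow> u = v"
| "chain u (a # as) v \<longleftrightarrow> arc_tail a = u \<and> chain (arc_head a) as v"

lemma chain_append: "chain u (xs @ ys) v \<longleftrightarrow> (\<exists>w. chain u xs w \<and> chain w ys v)"
  by (induction xs arbitrary: u) auto

lemma chain_nth:
  assumes "chain u as v" "k < length as"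
  shows "arc_head (as ! k) = (if Suc k < length as then arc_tail (as ! Suc k) else v)"
  using assms
proof (induction as arbitrary: u k)
  case (Cons a as)
  show ?case
  proof (cases k)
    case 0
    then show ?thesis using Cons.prems by (cases as) auto
  next
    case (Suc k')
    then show ?thesis using Cons.IH[of "arc_head a" k'] Cons.prems by auto
  qed
qed simp

lemma walk_imp_chain:
  "walk A u v s \<Longrightarrow> \<exists>as. chain u as v \<and> set as \<subseteq> A \<and> s = prod_list (map arc_sign as)"
proof (induction rule: walk.induct)
  case (walk_refl u)
  show ?case by (rule exI[of _ "[]"]) simp
next
  case (walk_step u v s w r)
  then obtain as where "chain u as v" "set as \<subseteq> A" "s = prod_list (map arc_sign as)" by blast
  moreover have "arc_sign (v, w, r) = r" by (simp add: arc_sign_def)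
  ultimately show ?case using walk_step.hyps
    by (intro exI[of _ "as @ [(v, w, r)]"]) (auto simp: chain_append arc_tail_def arc_head_def)
qed

lemma cycle_sign_set:
  assumes "distinct (map arc_tail as)"
  shows "cycle_sign (set as) = prod_list (map arc_sign as)"
  using assms unfolding cycle_sign_def by (simp add: distinct_map prod.distinct_set_conv_list)

text \<open>Induction on the length: a repeated tail cuts a closed chain into two shorter closed
  ones whose signs multiply to the original sign, so one of them still has a sign other than 1.
  Without repetition the chain is itself a cycle.\<close>

lemma closed_chain_imp_negative_cycle:
  assumes "chain u as u" "set as \<subseteq> A" "A \<subseteq> UNIV \<times> UNIV \<times> {-1, 1}"
    and "prod_list (map arc_sign as) \<noteq> 1"
  shows "\<exists>C. negative_cycle A C"
  using assms
proof (induction as arbitrary: u rule: length_induct)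
  case (1 as)
  note IH = "1.IH"
  have ne: "as \<noteq> []" using "1.prems" by auto
  show ?case
  proof (cases "distinct (map arc_tail as)")
    case True
    have u: "arc_tail (as ! 0) = u" using "1.prems"(1) ne by (cases as) auto
    have "arc_head (as ! k) = arc_tail (as ! (Suc k mod length as))" if "k < length as" for k
    proof (cases "Suc k < length as")
      case True
      then show ?thesis using chain_nth[OF "1.prems"(1) that] by simp
    next
      case False
      then have "Suc k = length as" using that by simp
      then show ?thesis using chain_nth[OF "1.prems"(1) that] u by simp
    qed
    then have cyc: "is_cycle A (set as)" unfolding is_cycle_def using "1.prems"(2) ne True by blast
    have "\<bar>prod_list (map arc_sign as)\<bar> = 1" using "1.prems"(2,3)
      by (induction as) (auto simp: arc_sign_def abs_mult)
    then have "cycle_sign (set as) = -1" using "1.prems"(4) cycle_sign_set[OF True] by linarith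
    then show ?thesis using cyc unfolding negative_cycle_def by blast
  next
    case False
    then obtain xs ys zs y where "map arc_tail as = xs @ [y] @ ys @ [y] @ zs"
      using not_distinct_decomp by blast
    then obtain as1 as' where 1: "as = as1 @ as'" "map arc_tail as' = y # ys @ y # zs"
      by (auto simp: map_eq_append_conv)
    then obtain a as'' where 2: "as' = a # as''" "arc_tail a = y" "map arc_tail as'' = ys @ y # zs"
      by (auto simp: map_eq_Cons_conv)
    then obtain as2 bs where 3: "as'' = as2 @ bs" "map arc_tail bs = y # zs"
      by (auto simp: map_eq_append_conv)
    then obtain b as3 where 4: "bs = b # as3" "arc_tail b = y" by (auto simp: map_eq_Cons_conv)
    have as: "as = as1 @ (a # as2) @ (b # as3)" and ab: "arc_tail a = arc_tail b"
      using 1 2 3 4 by simp_all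
    define w where "w = arc_tail a"
    have c: "chain w (a # as2) w" "chain u (as1 @ b # as3) u"
      using "1.prems"(1) ab unfolding as chain_append w_def by auto
    have "prod_list (map arc_sign as)
        = prod_list (map arc_sign (a # as2)) * prod_list (map arc_sign (as1 @ b # as3))"
      unfolding as by simp
    then have "prod_list (map arc_sign (a # as2)) \<noteq> 1 \<or> prod_list (map arc_sign (as1 @ b # as3)) \<noteq> 1"
      using "1.prems"(4) by force
    moreover have "set (a # as2) \<subseteq> A" "set (as1 @ b # as3) \<subseteq> A" using "1.prems"(2) as by auto
    moreover have "length (a # as2) < length as" "length (as1 @ b # as3) < length as"
      using as by auto
    ultimately show ?thesis using IH "1.prems"(3) c by blast
  qed
qed

lemma closed_walk_positive:
  assumes "walk A u u s" "A \<subseteq> UNIV \<times> UNIV \<times> {-1, 1}" "\<nexists>C. negative_cycle A C"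
  shows "s = 1"
  using walk_imp_chain[OF assms(1)] closed_chain_imp_negative_cycle[OF _ _ assms(2)] assms(3) by blast

lemma negative_cycle_mono: "negative_cycle A C \<Longrightarrow> A \<subseteq> B \<Longrightarrow> negative_cycle B C"
  unfolding negative_cycle_def is_cycle_def by blast

text \<open>The cycle is opened at the last arc of a list representing it. Tails are distinct, so
  this arc does not recur in the rest.\<close>

lemma negative_cycle_open_walk:
  assumes "negative_cycle A C"
  obtains t h r s where "(t, h, r) \<in> C" "walk (C - {(t, h, r)}) h t s" "s * r = -1"
proof -
  from assms obtain as where as: "as \<noteq> []" "set as = C" "distinct (map arc_tail as)"
    and hd: "\<And>k. k < length as \<Longrightarrow> arc_head (as ! k) = arc_tail (as ! (Suc k mod length as))"
    and sgn: "cycle_sign C = -1"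
    unfolding negative_cycle_def is_cycle_def by blast
  have W: "walk (set (take n as)) (arc_tail (as ! 0)) (arc_tail (as ! n))
      (prod_list (map arc_sign (take n as)))" if "n < length as" for n
    using that
  proof (induction n)
    case 0
    show ?case by (simp add: walk_refl)
  next
    case (Suc n)
    have tk: "take (Suc n) as = take n as @ [as ! n]" using Suc.prems by (simp add: take_Suc_conv_app_nth)
    have "as ! n = (arc_tail (as ! n), arc_tail (as ! Suc n), arc_sign (as ! n))"
      using hd[of n] Suc.prems by (simp add: arc_tail_def arc_head_def arc_sign_def prod_eq_iff)
    then have "(arc_tail (as ! n), arc_tail (as ! Suc n), arc_sign (as ! n)) \<in> set (take (Suc n) as)"
      unfolding tk by simp
    moreover have "walk (set (take (Suc n) as)) (arc_tail (as ! 0)) (arc_tail (as ! n))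
      (prod_list (map arc_sign (take n as)))"
      by (rule walk_mono[OF Suc.IH]) (use Suc.prems tk in auto)
    ultimately have "walk (set (take (Suc n) as)) (arc_tail (as ! 0)) (arc_tail (as ! Suc n))
      (prod_list (map arc_sign (take n as)) * arc_sign (as ! n))" by (rule walk_step[rotated])
    then show ?case unfolding tk by simp
  qed
  define n where "n = length as - 1"
  have n: "n < length as" "Suc n = length as" using as(1) unfolding n_def by (cases as; simp)+
  define t h r where "t = arc_tail (as ! n)" and "h = arc_tail (as ! 0)" and "r = arc_sign (as ! n)"
  have a: "as ! n = (t, h, r)"
    using hd[OF n(1)] n(2) by (simp add: t_def h_def r_def arc_tail_def arc_head_def arc_sign_def prod_eq_iff)
  have split: "as = take n as @ [(t, h, r)]" using n a by (metis take_Suc_conv_app_nth take_all_iff order_refl)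
  have "distinct (take n as @ [(t, h, r)])" using as(3) split by (metis distinct_map)
  then have "set (take n as) \<subseteq> C - {(t, h, r)}" using as(2) by (auto dest: in_set_takeD)
  then have "walk (C - {(t, h, r)}) h t (prod_list (map arc_sign (take n as)))"
    using W[OF n(1)] walk_mono unfolding t_def h_def by metis
  moreover have "prod_list (map arc_sign (take n as)) * r = -1"
  proof -
    have "prod_list (map arc_sign as) = -1" using sgn cycle_sign_set[OF as(3)] as(2) by simp
    then have "prod_list (map arc_sign (take n as @ [(t, h, r)])) = -1" using split by simp
    then show ?thesis by (simp add: arc_sign_def)
  qed
  moreover have "(t, h, r) \<in> C" using a n as(2) by (metis nth_mem)
  ultimately show ?thesis by (rule that[rotated 1])
qed

section \<open>Balancing a strong digraph with at most one negative cycle\<close>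

definition balanced :: "('a \<Rightarrow> bool) \<Rightarrow> 'a arc set \<Rightarrow> bool" where
  "balanced \<sigma> A \<longleftrightarrow> (\<forall>(u, v, s) \<in> A. s = (if \<sigma> u = \<sigma> v then 1 else -1))"

text \<open>The switch marks the vertices that positive walks from \<open>q\<close> reach. Appending
  an arc multiplies the sign of a walk, so the marks of its two ends determine the sign of the
  arc.\<close>

lemma balanced_if_walk_sign_unique:
  assumes A: "A \<subseteq> L \<times> L \<times> {-1, 1}"
    and reach: "\<And>v. v \<in> L \<Longrightarrow> \<exists>s. walk A q v s"
    and uniq: "\<And>v s s'. walk A q v s \<Longrightarrow> walk A q v s' \<Longrightarrow> s = s'"
  shows "\<exists>\<sigma>. balanced \<sigma> A"
proof -
  have "s = (if walk A q u 1 = walk A q v 1 then 1 else -1)" if a: "(u, v, s) \<in> A" for u v s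
  proof -
    have s: "s = 1 \<or> s = -1" and "u \<in> L" using A a by auto
    then obtain r where r: "walk A q u r" using reach by blast
    have r1: "r = 1 \<or> r = -1" using walk_sign[OF r] A by blast
    have v: "walk A q v (r * s)" using walk_step[OF r a] .
    have "walk A q u 1 \<longleftrightarrow> r = 1" using uniq[OF r, of 1] r by metis
    moreover have "walk A q v 1 \<longleftrightarrow> r * s = 1" using uniq[OF v, of 1] v by metis
    ultimately show ?thesis using s r1 by auto
  qed
  then have "balanced (\<lambda>v. walk A q v 1) A" unfolding balanced_def by blast
  then show ?thesis by blast
qed

text \<open>Two walks from \<open>q\<close> to \<open>v\<close> are closed by the same walk back to
  \<open>q\<close>. Both closed walks are positive, so the two signs are equal.\<close>

lemma balanced_if_no_negative_cycle:
  assumes A: "A \<subseteq> L \<times> L \<times> {-1, 1}"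
    and strong: "\<And>u v. u \<in> L \<Longrightarrow> v \<in> L \<Longrightarrow> \<exists>s. walk A u v s"
    and "q \<in> L" "\<nexists>C. negative_cycle A C"
  shows "\<exists>\<sigma>. balanced \<sigma> A"
proof (rule balanced_if_walk_sign_unique[OF A])
  fix v assume "v \<in> L"
  then show "\<exists>s. walk A q v s" using strong assms(3) by blast
next
  fix v s s' assume W: "walk A q v s" "walk A q v s'"
  have "v \<in> L" using W(1) assms(3) A by (cases rule: walk.cases) auto
  then obtain r where r: "walk A v q r" using strong assms(3) by blast
  have A': "A \<subseteq> UNIV \<times> UNIV \<times> {-1, 1}" using A by blast
  have "s * r = 1" "s' * r = 1"
    using closed_walk_positive[OF walk_trans[OF r W(1)] A' assms(4)]
      closed_walk_positive[OF walk_trans[OF r W(2)] A' assms(4)] by auto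
  then show "s = s'" using walk_sign[OF r A'] by auto
qed

lemma walk_first_exit:
  assumes "walk A u v s" "Q u" "\<not> Q v"
  obtains p q r s' where "(p, q, r) \<in> A" "walk A u p s'" "Q p" "\<not> Q q"
proof -
  have "Q v \<or> (\<exists>p q r s'. (p, q, r) \<in> A \<and> walk A u p s' \<and> Q p \<and> \<not> Q q)"
    using assms(1,2)
  proof (induction rule: walk.induct)
    case (walk_step u v s w r)
    show ?case
    proof (cases "Q v")
      case True
      then show ?thesis using walk_step.hyps by blast
    next
      case False
      then show ?thesis using walk_step.IH walk_step.prems by blast
    qed
  qed blast
  then show ?thesis using assms(3) that by blast
qed

text \<open>Remove an arc \<open>t \<rightarrow> h\<close> of the negative cycle \<open>C\<close>. Either the signs of the remaining walks
  from \<open>h\<close> are determined by their end points, or \<open>C\<close> has a first arc \<open>p \<rightarrow> q\<close> whose head is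
  reached from \<open>h\<close> with both signs. In the second case \<open>p \<rightarrow> q\<close> is the arc to delete: a walk of
  the wrong sign from \<open>q\<close> to \<open>p\<close> would close up to a negative walk that avoids an arc of \<open>C\<close>.\<close>

lemma balanced_up_to_one_arc:
  assumes A: "A \<subseteq> L \<times> L \<times> {-1, 1}"
    and strong: "\<And>u v. u \<in> L \<Longrightarrow> v \<in> L \<Longrightarrow> \<exists>s. walk A u v s"
    and neg: "negative_cycle A C" and uniq: "\<And>C'. negative_cycle A C' \<Longrightarrow> C' = C"
  shows "\<exists>b\<in>A. \<exists>\<sigma>. balanced \<sigma> (A - {b})"
proof -
  have A': "A \<subseteq> UNIV \<times> UNIV \<times> {-1, 1}" using A by blast
  have CA: "C \<subseteq> A" using neg unfolding negative_cycle_def is_cycle_def by blast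
  \<comment> \<open>A negative cycle avoiding an arc \<open>c\<close> of \<open>C\<close> would have
    to be \<open>C\<close>, so deleting any arc of \<open>C\<close> makes all closed walks
    positive.\<close>
  have pos: "s = 1" if "walk (A - {c}) u u s" "c \<in> C" for c u s
  proof (rule closed_walk_positive[OF that(1)])
    show "A - {c} \<subseteq> UNIV \<times> UNIV \<times> {-1, 1}" using A' by blast
    show "\<nexists>C'. negative_cycle (A - {c}) C'"
    proof
      assume "\<exists>C'. negative_cycle (A - {c}) C'"
      then obtain C' where C': "negative_cycle (A - {c}) C'" by blast
      then have "C' = C" using uniq negative_cycle_mono[OF C'] by blast
      moreover have "C' \<subseteq> A - {c}" using C' unfolding negative_cycle_def is_cycle_def by blast
      ultimately show False using that(2) by blast
    qed
  qed
  have sgn: "s = 1 \<or> s = -1" if "walk B u v s" "B \<subseteq> A" for B u v s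
    using walk_sign[OF walk_mono[OF that] A'] .
  have sgnA: "r = 1 \<or> r = -1" if "(u, v, r) \<in> A" for u v r using A that by blast
  obtain t h a s where a: "(t, h, a) \<in> C" and Q: "walk (C - {(t, h, a)}) h t s" "s * a = -1"
    by (rule negative_cycle_open_walk[OF neg])
  define D where "D = A - {(t, h, a)}"
  have DA: "D \<subseteq> A" unfolding D_def by blast
  have CD: "C - {(t, h, a)} \<subseteq> D" using CA unfolding D_def by blast
  have hL: "h \<in> L" "t \<in> L" using a CA A by auto
  have posD: "s = 1" if "walk D u u s" for u s using pos that a unfolding D_def by blast
  have reach_from: "\<exists>s. walk (A - {(p, q, r)}) q v s" if e: "(p, q, r) \<in> A" "v \<in> L" for p q r v
  proof -
    have "q \<in> L" using A e by blast
    then obtain s where "walk A q v s" using strong e by blast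
    then show ?thesis using walk_split_last[of A q v s p q r] by blast
  qed
  have reach_to: "\<exists>s. walk (A - {(p, q, r)}) v p s" if e: "(p, q, r) \<in> A" "v \<in> L" for p q r v
  proof -
    have "p \<in> L" using A e by blast
    then obtain s where "walk A v p s" using strong e by blast
    then show ?thesis using walk_split_first[of A v p s p q r] by blast
  qed
  have endL: "v \<in> L" if "walk A u v s" "u \<in> L" for u v s
    using that A by (cases rule: walk.cases) auto
  define det where "det v \<longleftrightarrow> (\<forall>s s'. walk D h v s \<longrightarrow> walk D h v s' \<longrightarrow> s = s')" for v
  show ?thesis
  proof (cases "det t")
    case True
    have "\<exists>\<sigma>. balanced \<sigma> D"
    proof (rule balanced_if_walk_sign_unique)
      show "D \<subseteq> L \<times> L \<times> {-1, 1}" using A DA by blast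
      show "\<exists>s. walk D h v s" if "v \<in> L" for v using reach_from that a CA unfolding D_def by blast
      show "s1 = s2" if W: "walk D h v s1" "walk D h v s2" for v s1 s2
      proof -
        have "v \<in> L" using endL[OF walk_mono[OF W(1) DA] hL(1)] .
        then obtain r where r: "walk D v t r" using reach_to a CA unfolding D_def by blast
        have "s1 * r = s2 * r" using True walk_trans[OF r] W unfolding det_def by blast
        then show ?thesis using sgn[OF r DA] by auto
      qed
    qed
    then show ?thesis using a CA unfolding D_def by blast
  next
    case False
    have "det h" unfolding det_def using posD by blast
    then obtain p q b sp where b: "(p, q, b) \<in> C - {(t, h, a)}" and Qp: "walk (C - {(t, h, a)}) h p sp"
      and det_p: "det p" and det_q: "\<not> det q"
      using walk_first_exit[OF Q(1), of det] False by blast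
    have bA: "(p, q, b) \<in> A" and bC: "(p, q, b) \<in> C" using b CA by auto
    have pD: "walk D h p sp" using walk_mono[OF Qp CD] .
    have b1: "b = 1 \<or> b = -1" using sgnA[OF bA] .
    have sp1: "sp = 1 \<or> sp = -1" using sgn[OF pD DA] .
    have a1: "a = 1 \<or> a = -1" using sgnA a CA by blast
    have qD: "walk D h q (sp * b)" using walk_step[OF pD] b CD by blast
    obtain w where w: "walk D h q w" "w \<noteq> sp * b" using det_q qD unfolding det_def by metis
    \<comment> \<open>A use of \<open>p \<rightarrow> q\<close> would split the walk into a walk to
      \<open>p\<close>, of sign \<open>sp\<close> by \<open>det p\<close>, the arc, and a closed
      walk at \<open>q\<close> in \<open>D\<close>, which is positive. The sign would be
      \<open>sp * b\<close>, which \<open>w\<close> is not.\<close>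
    have w': "walk (D - {(p, q, b)}) h q w"
    proof (rule ccontr)
      assume "\<not> ?thesis"
      then obtain s1 s2 where s: "walk (D - {(p, q, b)}) h p s1" "walk D q q s2" "w = s1 * b * s2"
        using walk_split_first[OF w(1)] by blast
      have "walk D h p s1" using walk_mono[OF s(1)] by blast
      then have "s1 = sp" using det_p pD unfolding det_def by blast
      then show False using s(3) posD[OF s(2)] w(2) by simp
    qed
    have w1: "w = - (sp * b)" using w(2) sgn[OF w(1) DA] b1 sp1 by auto
    let ?B = "A - {(p, q, b)}"
    have BA: "?B \<subseteq> A" by blast
    have wB: "walk ?B h q w" by (rule walk_mono[OF w']) (auto simp: D_def)
    \<comment> \<open>Suppose \<open>p \<rightarrow> q\<close> closes the walk positively. If the
      walk lies in \<open>D\<close>, then preceded by the walk of sign \<open>w\<close> it gives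
      walks from \<open>h\<close> to \<open>p\<close> a second sign. Otherwise it is cut at its last
      use of \<open>t \<rightarrow> h\<close>, and the part up to there, preceded by the walk of
      sign \<open>w\<close>, is a negative closed walk at \<open>h\<close> avoiding an arc of
      \<open>C\<close>.\<close>
    have return: "x * b = -1" if X: "walk ?B q p x" for x
    proof (rule ccontr)
      assume "x * b \<noteq> -1"
      then have xb: "x * b = 1" using sgn[OF X BA] b1 by auto
      show False
        using walk_split_last[OF X, of t h a]
      proof
        assume "walk (?B - {(t, h, a)}) q p x"
        then have "walk D q p x" by (rule walk_mono) (auto simp: D_def)
        then have "w * x = sp" using walk_trans[OF _ w(1)] det_p pD unfolding det_def by blast
        then show False using w1 xb sp1 by (auto simp: algebra_simps)
      next
        assume "\<exists>s1 s2. walk ?B q t s1 \<and> walk (?B - {(t, h, a)}) h p s2 \<and> x = s1 * a * s2"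
        then obtain s1 s2 where s: "walk ?B q t s1" "walk (?B - {(t, h, a)}) h p s2"
          and x: "x = s1 * a * s2" by blast
        have "walk D h p s2" by (rule walk_mono[OF s(2)]) (auto simp: D_def)
        then have s2: "s2 = sp" using det_p pD unfolding det_def by blast
        have "(t, h, a) \<in> ?B" using a b CA by auto
        then have "walk ?B h h (w * s1 * a)" by (rule walk_step[OF walk_trans[OF s(1) wB]])
        then have "w * s1 * a = 1" using pos bC by blast
        then show False using w1 xb x s2 sp1 b1 a1 sgn[OF s(1) BA] by auto
      qed
    qed
    have "\<exists>\<sigma>. balanced \<sigma> ?B"
    proof (rule balanced_if_walk_sign_unique)
      show "?B \<subseteq> L \<times> L \<times> {-1, 1}" using A by blast
      show "\<exists>s. walk ?B q v s" if "v \<in> L" for v using reach_from bA that by blast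
      show "s1 = s2" if W: "walk ?B q v s1" "walk ?B q v s2" for v s1 s2
      proof -
        have "q \<in> L" using bA A by blast
        then have "v \<in> L" using endL[OF walk_mono[OF W(1) BA]] by blast
        then obtain r where r: "walk ?B v p r" using reach_to bA by blast
        have "s1 * r * b = -1" "s2 * r * b = -1" using return walk_trans[OF r] W by blast+
        then show ?thesis using sgn[OF r BA] b1 by auto
      qed
    qed
    then show ?thesis using bA by blast
  qed
qed

text \<open>At most one arc spoils the balance, so it suffices to ignore all arcs into its head;
  without a negative cycle any vertex serves as \<open>j\<close>.\<close>

lemma balanced_off_vertex:
  assumes A: "A \<subseteq> L \<times> L \<times> {-1, 1}"
    and strong: "\<And>u v. u \<in> L \<Longrightarrow> v \<in> L \<Longrightarrow> \<exists>s. walk A u v s"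
    and "L \<noteq> {}" and uniq: "\<exists>\<^sub>\<le>\<^sub>1C. negative_cycle A C"
  obtains j \<sigma> where "j \<in> L" "balanced \<sigma> {(u, v, s) \<in> A. v \<noteq> j}"
proof (cases "\<exists>C. negative_cycle A C")
  case False
  obtain q where q: "q \<in> L" using assms(3) by blast
  obtain \<sigma> where "balanced \<sigma> A" using balanced_if_no_negative_cycle[OF A strong q False] by blast
  then show ?thesis using that q unfolding balanced_def by blast
next
  case True
  then obtain C where C: "negative_cycle A C" by blast
  then have "C' = C" if "negative_cycle A C'" for C' using uniq that by (auto dest: Uniq_D)
  then obtain p j b \<sigma> where "(p, j, b) \<in> A" and \<sigma>: "balanced \<sigma> (A - {(p, j, b)})"
    using balanced_up_to_one_arc[OF A strong C] by (metis prod_cases3)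
  moreover have "balanced \<sigma> {(u, v, s) \<in> A. v \<noteq> j}" using \<sigma> unfolding balanced_def by blast
  ultimately show ?thesis using that A by blast
qed

section \<open>Attractors of networks\<close>

text \<open>Updates inside such a set depend only on the coordinates in it
  (\<open>local_eq\<close>), so it can stand for the components already treated.\<close>

definition pred_closed :: "'a arc set \<Rightarrow> 'a set \<Rightarrow> bool" where
  "pred_closed E P \<longleftrightarrow> (\<forall>(u, v, s) \<in> E. v \<in> P \<longrightarrow> u \<in> P)"

text \<open>The order that is pointwise on \<open>L\<close> after switching along \<open>\<sigma>\<close>, so that \<open>\<sigma>\<close> is the top;
  replacing \<open>\<sigma>\<close> by its negation reverses it.\<close>

definition below :: "'a set \<Rightarrow> ('a \<Rightarrow> bool) \<Rightarrow> 'a config \<Rightarrow> 'a config \<Rightarrow> bool" where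
  "below L \<sigma> x y \<longleftrightarrow> (\<forall>i\<in>L. x i = \<sigma> i \<longrightarrow> y i = \<sigma> i)"

definition agree :: "'a set \<Rightarrow> 'a config \<Rightarrow> 'a config \<Rightarrow> bool" where
  "agree P x y \<longleftrightarrow> (\<forall>i\<in>P. x i = y i)"

lemma balanced_uminus: "balanced \<sigma> A \<Longrightarrow> balanced (\<lambda>i. \<not> \<sigma> i) A"
  unfolding balanced_def by auto

lemma flip_in_configs: "x \<in> configs V \<Longrightarrow> i \<in> V \<Longrightarrow> flip x i \<in> configs V"
  unfolding configs_def flip_def by (auto simp: PiE_iff extensional_def)

lemma configs_eqI: "x \<in> configs V \<Longrightarrow> y \<in> configs V \<Longrightarrow> agree V x y \<Longrightarrow> x = y"
  unfolding configs_def agree_def by (auto intro: PiE_ext)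

text \<open>If \<open>X\<close> never takes the value \<open>x i\<close> at \<open>i\<close>, the
  half-cube with the opposite value there contains \<open>X\<close> and excludes
  \<open>x\<close>.\<close>

lemma subspace_hull_value:
  assumes "X \<noteq> {}" "X \<subseteq> configs V" "x \<in> subspace_hull V X" "i \<in> V"
  shows "\<exists>a\<in>X. a i = x i"
proof (rule ccontr)
  assume no: "\<not> ?thesis"
  let ?S = "{y \<in> configs V. \<forall>k\<in>{i}. y k = (\<not> x i)}"
  have "config_subspace V ?S" unfolding config_subspace_def
    by (rule exI[of _ "{i}"], rule exI[of _ "\<lambda>_. \<not> x i"]) (use assms(4) in auto)
  moreover have "X \<subseteq> ?S" using no assms(2) by auto
  ultimately have "x \<in> ?S" using smallest_subspace(3)[OF assms(1,2)] assms(3) by blast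
  then show False by simp
qed

section \<open>Asynchronous dynamics of a fixed network\<close>

locale network =
  fixes V :: "'a set" and E :: "'a arc set" and f :: "'a config \<Rightarrow> 'a config"
  assumes finite_V: "finite V" and f_network: "f \<in> networks_on V E"
begin

abbreviation \<Gamma> :: "'a config rel" where "\<Gamma> \<equiv> async_graph V f"

lemma arcs_in_V: "(u, v, s) \<in> E \<Longrightarrow> u \<in> V \<and> v \<in> V"
  using f_network unfolding networks_on_def interaction_arcs_def by blast

lemma arc_of_variation:
  assumes x: "x \<in> configs V" and "k \<in> V" "i \<in> V" and ne: "f x i \<noteq> f (flip x k) i"
  shows "(k, i, if f (flip x k) i = flip x k k then 1 else -1) \<in> E"
proof -
  have E: "E = interaction_arcs V f" using f_network unfolding networks_on_def by blast
  \<comment> \<open>\<open>interaction_arcs\<close> looks at the end of the edge with value 0 at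
    \<open>k\<close>.\<close>
  define y where "y = (if x k then flip x k else x)"
  have y: "y \<in> configs V" "\<not> y k"
    using flip_in_configs[OF x assms(2)] x by (auto simp: y_def flip_def)
  have "variation f k i y > 0" if "f (flip x k) i = flip x k k"
    using that ne fun_upd_idem[of x k True] by (auto simp: y_def variation_def flip_def split: if_splits)
  moreover have "variation f k i y < 0" if "f (flip x k) i \<noteq> flip x k k"
    using that ne fun_upd_idem[of x k True] by (auto simp: y_def variation_def flip_def split: if_splits)
  ultimately show ?thesis unfolding E interaction_arcs_def using y assms(2,3) by auto
qed

text \<open>Coordinates are switched from \<open>x\<close> to \<open>y\<close> one by one; the first
  switch that changes \<open>f\<close> at \<open>i\<close> gives the arc. After it, being Boolean,
  coordinate \<open>k\<close> and the local value at \<open>i\<close> are those of \<open>y\<close>,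
  so the sign can be written in terms of \<open>y\<close> alone.\<close>

lemma arc_of_difference:
  assumes "x \<in> configs V" "y \<in> configs V" "i \<in> V" "f x i \<noteq> f y i"
  obtains k where "k \<in> V" "x k \<noteq> y k" "(k, i, if f y i = y k then 1 else -1) \<in> E"
proof -
  have "\<exists>k\<in>V. x k \<noteq> y k \<and> (k, i, if f y i = y k then 1 else -1) \<in> E"
    using assms(1,4)
  proof (induction "card {k \<in> V. x k \<noteq> y k}" arbitrary: x)
    case 0
    then have "agree V x y" using finite_V by (auto simp: agree_def)
    then show ?case using configs_eqI[OF _ assms(2)] 0 by blast
  next
    case (Suc n)
    have "{k \<in> V. x k \<noteq> y k} \<noteq> {}"
    proof
      assume "{k \<in> V. x k \<noteq> y k} = {}"
      then show False using Suc.hyps(2) by (simp only: card.empty)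
    qed
    then obtain k where k: "k \<in> V" "x k \<noteq> y k" by blast
    show ?case
    proof (cases "f x i = f (flip x k) i")
      case True
      have "{l \<in> V. x l \<noteq> y l} = insert k {l \<in> V. flip x k l \<noteq> y l}"
        "k \<notin> {l \<in> V. flip x k l \<noteq> y l}" using k by (auto simp: flip_def)
      then have "n = card {l \<in> V. flip x k l \<noteq> y l}" using Suc.hyps(2) finite_V by simp
      then obtain l where "l \<in> V" "flip x k l \<noteq> y l" "(l, i, if f y i = y l then 1 else -1) \<in> E"
        using Suc.hyps(1)[of "flip x k"] flip_in_configs[OF Suc.prems(1) k(1)] Suc.prems(2) True by auto
      then show ?thesis using k by (auto simp: flip_def split: if_splits)
    next
      case False
      have eq: "f (flip x k) i = f y i" "flip x k k = y k" using False Suc.prems k by (auto simp: flip_def)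
      have "(k, i, if f y i = y k then 1 else -1) \<in> E"
        using arc_of_variation[OF Suc.prems(1) k(1) assms(3) False] unfolding eq .
      then show ?thesis using k by blast
    qed
  qed
  then show ?thesis using that by blast
qed

lemma local_eq:
  assumes "pred_closed E P" "x \<in> configs V" "y \<in> configs V" "agree P x y" "i \<in> P" "i \<in> V"
  shows "f x i = f y i"
proof (rule ccontr)
  assume "\<not> ?thesis"
  then obtain k where "x k \<noteq> y k" "(k, i, if f y i = y k then 1 else -1) \<in> E"
    using arc_of_difference assms by metis
  then show False using assms(1,4,5) unfolding pred_closed_def agree_def by blast
qed

text \<open>If the value \<open>\<sigma> i\<close> were lost, some arc would enter \<open>i\<close>
  from a coordinate of \<open>L\<close> where \<open>y\<close> is at \<open>\<sigma>\<close> and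
  \<open>x\<close> is not, with a sign that contradicts the balance.\<close>

lemma local_mono:
  assumes "pred_closed E (P \<union> L)" "L \<subseteq> V"
    and bal: "balanced \<sigma> {(u, v, s) \<in> E. u \<in> L \<and> v \<in> L \<and> v \<noteq> j}"
    and "x \<in> configs V" "y \<in> configs V" "agree P x y" "below L \<sigma> x y"
    and "i \<in> L" "i \<noteq> j" "f x i = \<sigma> i"
  shows "f y i = \<sigma> i"
proof (rule ccontr)
  assume ne: "\<not> ?thesis"
  then have "f x i \<noteq> f y i" "i \<in> V" using assms by auto
  then obtain k where k: "x k \<noteq> y k" "(k, i, if f y i = y k then 1 else -1) \<in> E"
    using arc_of_difference assms(4,5) by metis
  then have "k \<in> L" using assms(1,6,8) unfolding pred_closed_def agree_def by blast
  then have "y k = \<sigma> k" using k(1) assms(7) unfolding below_def by auto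
  moreover have "(if f y i = y k then 1 else -1 :: int) = (if \<sigma> k = \<sigma> i then 1 else -1)"
    using bal k(2) \<open>k \<in> L\<close> assms(8,9) unfolding balanced_def by blast
  ultimately show False using ne by (auto split: if_splits)
qed

lemma attractor_configs: "attractor V \<Gamma> A \<Longrightarrow> x \<in> A \<Longrightarrow> x \<in> configs V"
  unfolding attractor_def trap_set_def by blast

lemma attractor_flip:
  "attractor V \<Gamma> A \<Longrightarrow> x \<in> A \<Longrightarrow> i \<in> V \<Longrightarrow> f x i \<noteq> x i \<Longrightarrow> flip x i \<in> A"
  unfolding attractor_def trap_set_def async_graph_def by blast

lemma trap_setI:
  assumes "T \<subseteq> configs V" "\<And>x i. x \<in> T \<Longrightarrow> i \<in> V \<Longrightarrow> f x i \<noteq> x i \<Longrightarrow> flip x i \<in> T"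
  shows "trap_set V \<Gamma> T"
  using assms unfolding trap_set_def async_graph_def by blast

text \<open>The way to prove a property on all of an attractor: it holds somewhere and updates
  preserve it.\<close>

lemma attractor_minimal:
  assumes A: "attractor V \<Gamma> A" and "T \<subseteq> A" "T \<noteq> {}"
    and "\<And>x i. x \<in> T \<Longrightarrow> i \<in> V \<Longrightarrow> f x i \<noteq> x i \<Longrightarrow> flip x i \<in> T"
  shows "T = A"
proof -
  have "T \<subseteq> configs V" using attractor_configs[OF A] assms(2) by blast
  then have "trap_set V \<Gamma> T" using assms(4) by (rule trap_setI)
  then show ?thesis using assms(1-3) unfolding attractor_def by blast
qed

lemma attractor_reach:
  assumes A: "attractor V \<Gamma> A" and "(x, y) \<in> \<Gamma>\<^sup>*" "x \<in> A"
  shows "y \<in> A"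
  using assms(2,3)
  by (induction rule: rtrancl_induct) (use A in \<open>auto simp: attractor_def trap_set_def\<close>)

lemma attractor_connected:
  assumes A: "attractor V \<Gamma> A" and "x \<in> A" "y \<in> A"
  shows "(x, y) \<in> \<Gamma>\<^sup>*"
proof -
  have "{z. (x, z) \<in> \<Gamma>\<^sup>*} = A"
  proof (rule attractor_minimal[OF A])
    show "{z. (x, z) \<in> \<Gamma>\<^sup>*} \<subseteq> A" using attractor_reach[OF A] assms by blast
    show "{z. (x, z) \<in> \<Gamma>\<^sup>*} \<noteq> {}" by blast
    show "flip z i \<in> {z. (x, z) \<in> \<Gamma>\<^sup>*}" if z: "z \<in> {z. (x, z) \<in> \<Gamma>\<^sup>*}" "i \<in> V" "f z i \<noteq> z i" for z i
    proof -
      have "z \<in> configs V" using attractor_reach[OF A] attractor_configs[OF A] z assms by blast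
      then have "(z, flip z i) \<in> \<Gamma>" using z unfolding async_graph_def by blast
      then show ?thesis using z(1) by auto
    qed
  qed
  then show ?thesis using assms by blast
qed

text \<open>The path from \<open>x\<close> to \<open>y\<close> is replayed from \<open>z\<close>,
  skipping updates outside \<open>P\<close>. Those inside remain available because the replay agrees
  on \<open>P\<close> with the original path.\<close>

lemma reach_override:
  assumes P: "pred_closed E P" and "(x, y) \<in> \<Gamma>\<^sup>*" and z: "z \<in> configs V" "agree P z x"
  shows "(z, override_on z y P) \<in> \<Gamma>\<^sup>* \<and> override_on z y P \<in> configs V"
  using assms(2)
proof (induction rule: rtrancl_induct)
  case base
  have "override_on z x P = z" using z(2) by (auto simp: override_on_def agree_def)
  then show ?case using z by simp
next
  case (step y y')
  let ?w = "override_on z y P"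
  obtain i where i: "y' = flip y i" "i \<in> V" "f y i \<noteq> y i" and y: "y \<in> configs V"
    using step.hyps(2) unfolding async_graph_def by blast
  show ?case
  proof (cases "i \<in> P")
    case True
    have "f ?w i = f y i"
      by (rule local_eq[OF P _ y _ True i(2)]) (use step.IH in \<open>auto simp: agree_def\<close>)
    then have "(?w, flip ?w i) \<in> \<Gamma>" using i True step.IH unfolding async_graph_def by auto
    moreover have "flip ?w i = override_on z y' P"
      using True unfolding i(1) by (auto simp: flip_def override_on_def fun_eq_iff)
    ultimately show ?thesis using step.IH flip_in_configs[OF _ i(2), of ?w] by auto
  next
    case False
    have "override_on z y' P = ?w" using False unfolding i(1) by (auto simp: flip_def override_on_def fun_eq_iff)
    then show ?thesis using step.IH by simp
  qed
qed

text \<open>Once \<open>A\<close> and \<open>B\<close> share one \<open>P\<close>-part, every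
  \<open>P\<close>-part of \<open>A\<close> can be carried over to \<open>B\<close>.\<close>

lemma attractor_override:
  assumes "pred_closed E P" and A: "attractor V \<Gamma> A" "x \<in> A" "y \<in> A"
    and B: "attractor V \<Gamma> B" "z \<in> B" "agree P z x"
  shows "override_on z y P \<in> B"
proof (rule attractor_reach[OF B(1) _ B(2)])
  show "(z, override_on z y P) \<in> \<Gamma>\<^sup>*"
    using reach_override[OF assms(1) attractor_connected[OF A] attractor_configs[OF B(1,2)] B(3)]
    by (rule conjunct1)
qed

lemma attractor_mix:
  assumes P: "pred_closed E P" and A: "attractor V \<Gamma> A" "x \<in> A" "y \<in> A"
  shows "override_on x y P \<in> A"
  by (rule attractor_override[OF P A A(1,2)]) (simp add: agree_def)

end

section \<open>Largest configurations of attractors on one layer \<open>L\<close>, over the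
  components \<open>P\<close> before it\<close>

locale network_layer = network V E f for V E and f :: "'a config \<Rightarrow> 'a config" +
  fixes P L :: "'a set" and j :: 'a
  assumes P_closed: "pred_closed E P" and PL_closed: "pred_closed E (P \<union> L)"
    and disj: "P \<inter> L = {}" and L_V: "L \<subseteq> V" and j_L: "j \<in> L"
begin

text \<open>Arcs into \<open>j\<close> are left out because they may be unbalanced.\<close>

abbreviation layer_arcs :: "'a arc set" where
  "layer_arcs \<equiv> {(u, v, s) \<in> E. u \<in> L \<and> v \<in> L \<and> v \<noteq> j}"

lemma attractor_top:
  assumes bal: "balanced \<sigma> layer_arcs" and A: "attractor V \<Gamma> A"
  obtains z where "z \<in> A" "\<And>w. w \<in> A \<Longrightarrow> below L \<sigma> w z"
proof -
  \<comment> \<open>Preferring the value \<open>\<sigma> j\<close> at \<open>j\<close> ensures that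
    updates of \<open>j\<close> cannot leave the set below \<open>z\<close>, although
    \<open>f\<close> is not controlled there.\<close>
  define A' where "A' = (if \<exists>w\<in>A. w j = \<sigma> j then {w\<in>A. w j = \<sigma> j} else A)"
  define m where "m w = card {i\<in>L. w i = \<sigma> i}" for w
  have finL: "finite L" using L_V finite_V finite_subset by blast
  have "A' \<noteq> {}" using A unfolding A'_def attractor_def by auto
  then obtain w0 where "w0 \<in> A'" by blast
  moreover have "m w < Suc (card L)" for w
    unfolding m_def less_Suc_eq_le using finL by (auto intro: card_mono)
  ultimately obtain z where z: "z \<in> A'" "\<And>w. w \<in> A' \<Longrightarrow> m w \<le> m z"
    using ex_has_greatest_nat[of "\<lambda>w. w \<in> A'" w0 m "Suc (card L)"] by blast
  have zA: "z \<in> A" using z(1) unfolding A'_def by (auto split: if_splits)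
  have A'_cong: "w \<in> A'" if "w \<in> A" "w j = z j" for w
    using z(1) that unfolding A'_def by (auto split: if_splits)
  let ?T = "{w\<in>A. below L \<sigma> w z}"
  have "?T = A"
  proof (rule attractor_minimal[OF A])
    show "?T \<noteq> {}" using zA by (auto simp: below_def)
    show "flip w i \<in> ?T" if w: "w \<in> ?T" and i: "i \<in> V" "f w i \<noteq> w i" for w i
    proof -
      have wA: "w \<in> A" and wz: "below L \<sigma> w z" using w by auto
      have w'A: "flip w i \<in> A" using attractor_flip[OF A wA i] .
      have "z i = \<sigma> i" if iL: "i \<in> L" and up: "f w i = \<sigma> i"
      proof (cases "i = j")
        case True
        have "flip w i j = \<sigma> j" using True up i by (auto simp: flip_def)
        then show ?thesis using w'A z(1) True unfolding A'_def by (auto split: if_splits)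
      next
        case False
        \<comment> \<open>Giving \<open>z\<close> the \<open>P\<close>-part of \<open>w\<close>
          leaves only \<open>L\<close> to compare, as monotonicity requires; mixing keeps
          \<open>?z\<close> in \<open>A\<close>. An upward update of \<open>?z\<close> at
          \<open>i\<close> would then raise the count \<open>m\<close> without changing the value at
          \<open>j\<close>.\<close>
        let ?z = "override_on z w P"
        have z'A: "?z \<in> A" by (rule attractor_mix[OF P_closed A zA wA])
        have zL: "?z k = z k" if "k \<in> L" for k using that disj by (auto simp: override_on_def)
        have "f ?z i = \<sigma> i"
          by (rule local_mono[OF PL_closed L_V bal attractor_configs[OF A wA]
                attractor_configs[OF A z'A] _ _ iL False up])
            (use wz zL in \<open>auto simp: agree_def below_def\<close>)
        show ?thesis
        proof (rule ccontr)
          assume ne: "z i \<noteq> \<sigma> i"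
          then have "flip ?z i \<in> A"
            using attractor_flip[OF A z'A i(1)] zL[OF iL] \<open>f ?z i = \<sigma> i\<close> by auto
          moreover have "flip ?z i j = z j" using zL[OF j_L] False by (simp add: flip_def)
          ultimately have "m (flip ?z i) \<le> m z" using A'_cong z(2) by blast
          moreover have "{k\<in>L. flip ?z i k = \<sigma> k} = insert i {k\<in>L. z k = \<sigma> k}"
            using zL iL ne by (auto simp: flip_def)
          ultimately show False using ne finL unfolding m_def by simp
        qed
      qed
      then show ?thesis using w'A wz i by (auto simp: below_def flip_def)
    qed
  qed blast
  then show ?thesis using that zA by blast
qed

text \<open>Nothing is known about \<open>f\<^sub>j\<close>, which is why \<open>\<sigma>\<close> is chosen with \<open>x j = \<sigma> j\<close>: the top of
  \<open>B\<close> then has the value \<open>\<sigma> j\<close> at \<open>j\<close>, so updates of \<open>j\<close> cannot leave the set below it.\<close>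

lemma attractor_below_top:
  assumes bal: "balanced \<sigma> layer_arcs" and A: "attractor V \<Gamma> A" and B: "attractor V \<Gamma> B"
    and ab: "a \<in> A" "b \<in> B" "agree P a b"
    and xA: "\<And>i. i \<in> V \<Longrightarrow> \<exists>a\<in>A. a i = x i" and xB: "\<And>i. i \<in> V \<Longrightarrow> \<exists>b\<in>B. b i = x i"
    and xj: "x j = \<sigma> j"
    and z: "z \<in> B" "\<And>w. w \<in> B \<Longrightarrow> below L \<sigma> w z"
    and "w \<in> A"
  shows "below L \<sigma> w z"
proof -
  obtain y where y: "y \<in> A" "\<And>w. w \<in> A \<Longrightarrow> below L (\<lambda>i. \<not> \<sigma> i) w y"
    using attractor_top[OF balanced_uminus[OF bal] A] by blast
  have xz: "z i = \<sigma> i" if "i \<in> L" "x i = \<sigma> i" for i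
    using that xB[of i] z(2) L_V unfolding below_def by (metis subsetD)
  have yx: "x i = \<sigma> i" if "i \<in> L" "y i = \<sigma> i" for i
    using that xA[of i] y(2) L_V unfolding below_def by (metis subsetD)
  let ?T = "{w\<in>A. below L \<sigma> w z}"
  have "?T = A"
  proof (rule attractor_minimal[OF A])
    \<comment> \<open>The bottom \<open>y\<close> of \<open>A\<close> is below \<open>z\<close>,
      with \<open>x\<close> in between.\<close>
    show "?T \<noteq> {}" using y(1) xz yx by (auto simp: below_def)
    show "flip w i \<in> ?T" if w: "w \<in> ?T" and i: "i \<in> V" "f w i \<noteq> w i" for w i
    proof -
      have wA: "w \<in> A" and wz: "below L \<sigma> w z" using w by auto
      have w'A: "flip w i \<in> A" using attractor_flip[OF A wA i] .
      have "z i = \<sigma> i" if iL: "i \<in> L" and up: "f w i = \<sigma> i"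
      proof (cases "i = j")
        case True
        then show ?thesis using xz[OF iL] xj by simp
      next
        case False
        \<comment> \<open>The \<open>P\<close>-part of \<open>w\<close> is carried first to
          \<open>b\<close>, through the part shared with \<open>a\<close>, and then to
          \<open>z\<close> inside \<open>B\<close>.\<close>
        have "override_on b w P \<in> B"
          by (rule attractor_override[OF P_closed A ab(1) wA B ab(2)]) (use ab(3) in \<open>auto simp: agree_def\<close>)
        then have "override_on z (override_on b w P) P \<in> B"
          by (rule attractor_mix[OF P_closed B z(1)])
        moreover have "override_on z (override_on b w P) P = override_on z w P"
          by (auto simp: override_on_def)
        ultimately have z'B: "override_on z w P \<in> B" (is "?z \<in> B") by simp
        have zL: "?z k = z k" if "k \<in> L" for k using that disj by (auto simp: override_on_def)
        have up': "f ?z i = \<sigma> i"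
          by (rule local_mono[OF PL_closed L_V bal attractor_configs[OF A wA]
                attractor_configs[OF B z'B] _ _ iL False up])
            (use wz zL in \<open>auto simp: agree_def below_def\<close>)
        show ?thesis
        proof (rule ccontr)
          assume ne: "z i \<noteq> \<sigma> i"
          then have "flip ?z i \<in> B"
            using attractor_flip[OF B z'B i(1)] zL[OF iL] up' by auto
          moreover have "flip ?z i i = \<sigma> i" using ne zL[OF iL] by (auto simp: flip_def)
          ultimately show False using z(2) iL ne unfolding below_def by blast
        qed
      qed
      then show ?thesis using w'A wz i by (auto simp: below_def flip_def)
    qed
  qed blast
  then show ?thesis using assms(12) by blast
qed

text \<open>Each top bounds the other attractor, so the two tops coincide on \<open>L\<close>;
  exchanging the \<open>P\<close>-part makes them agree on \<open>P\<close> as well.\<close>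

lemma attractors_agree_on_layer:
  assumes bal: "balanced \<sigma> layer_arcs" and A: "attractor V \<Gamma> A" and B: "attractor V \<Gamma> B"
    and ab: "a \<in> A" "b \<in> B" "agree P a b"
    and xA: "\<And>i. i \<in> V \<Longrightarrow> \<exists>a\<in>A. a i = x i" and xB: "\<And>i. i \<in> V \<Longrightarrow> \<exists>b\<in>B. b i = x i"
  shows "\<exists>a\<in>A. \<exists>b\<in>B. agree (P \<union> L) a b"
proof -
  define \<tau> where "\<tau> = (if x j = \<sigma> j then \<sigma> else (\<lambda>i. \<not> \<sigma> i))"
  have bal': "balanced \<tau> layer_arcs" using bal balanced_uminus unfolding \<tau>_def by auto
  have xj: "x j = \<tau> j" unfolding \<tau>_def by auto
  obtain y where y: "y \<in> A" "\<And>w. w \<in> A \<Longrightarrow> below L \<tau> w y" using attractor_top[OF bal' A] by blast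
  obtain z where z: "z \<in> B" "\<And>w. w \<in> B \<Longrightarrow> below L \<tau> w z" using attractor_top[OF bal' B] by blast
  have ba: "agree P b a" using ab(3) by (auto simp: agree_def)
  have "below L \<tau> y z" by (rule attractor_below_top[OF bal' A B ab xA xB xj z y(1)])
  moreover have "below L \<tau> z y"
    by (rule attractor_below_top[OF bal' B A ab(2,1) ba xB xA xj y z(1)])
  ultimately have yz: "agree L y z" unfolding below_def agree_def by blast
  have "override_on b y P \<in> B" by (rule attractor_override[OF P_closed A ab(1) y(1) B ab(2) ba])
  then have "override_on z (override_on b y P) P \<in> B" by (rule attractor_mix[OF P_closed B z(1)])
  moreover have "agree (P \<union> L) y (override_on z (override_on b y P) P)"
    using yz disj unfolding agree_def override_on_def by auto
  ultimately show ?thesis using y(1) by blast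
qed

end

section \<open>Separation and trapping\<close>

context network
begin

lemma separating_graph_if_unique_negative_cycle:
  assumes E: "signed_digraph V E" and uniq: "\<exists>\<^sub>\<le>\<^sub>1C. negative_cycle E C"
  shows "separating_graph V \<Gamma>"
  unfolding separating_graph_def
proof (intro allI impI, rule ccontr)
  fix A B
  assume AB: "attractor V \<Gamma> A \<and> attractor V \<Gamma> B \<and> A \<noteq> B"
    and meet: "subspace_hull V A \<inter> subspace_hull V B \<noteq> {}"
  then have A: "attractor V \<Gamma> A" and B: "attractor V \<Gamma> B" and ne: "A \<noteq> B" by auto
  obtain x where x: "x \<in> subspace_hull V A" "x \<in> subspace_hull V B" using meet by blast
  have "A \<noteq> {}" "A \<subseteq> configs V" "B \<noteq> {}" "B \<subseteq> configs V"
    using A B unfolding attractor_def trap_set_def by auto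
  then have xA: "\<And>i. i \<in> V \<Longrightarrow> \<exists>a\<in>A. a i = x i" and xB: "\<And>i. i \<in> V \<Longrightarrow> \<exists>b\<in>B. b i = x i"
    using subspace_hull_value x by metis+
  \<comment> \<open>A largest \<open>good\<close> set cannot be \<open>V\<close>, since attractors
    with a common configuration are equal; yet otherwise one more layer can be added to it.\<close>
  define good where "good P \<longleftrightarrow> P \<subseteq> V \<and> pred_closed E P \<and> (\<exists>a\<in>A. \<exists>b\<in>B. agree P a b)" for P
  have "good {}" using \<open>A \<noteq> {}\<close> \<open>B \<noteq> {}\<close> unfolding good_def pred_closed_def agree_def by auto
  moreover have "card P < Suc (card V)" if "good P" for P
    using that finite_V unfolding good_def less_Suc_eq_le by (auto intro: card_mono)
  ultimately obtain P where P: "good P" "\<And>Q. good Q \<Longrightarrow> card Q \<le> card P"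
    using ex_has_greatest_nat[of good "{}" card "Suc (card V)"] by blast
  obtain a b where ab: "a \<in> A" "b \<in> B" "agree P a b" and PV: "P \<subseteq> V" and Pc: "pred_closed E P"
    using P(1) unfolding good_def by blast
  have "P \<noteq> V"
  proof
    assume "P = V"
    then have "a = b" using configs_eqI attractor_configs A B ab by metis
    then have "B = A" using ab attractor_connected[OF A] attractor_connected[OF B]
        attractor_reach[OF A] attractor_reach[OF B] by blast
    then show False using ne by simp
  qed
  \<comment> \<open>A smallest closed extension of \<open>P\<close> adds a single strongly connected
    layer.\<close>
  define ext where "ext Q \<longleftrightarrow> P \<subset> Q \<and> Q \<subseteq> V \<and> pred_closed E Q" for Q
  have "ext V" using PV \<open>P \<noteq> V\<close> arcs_in_V unfolding ext_def pred_closed_def by blast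
  then obtain Q where Q: "ext Q" "\<And>R. ext R \<Longrightarrow> card Q \<le> card R"
    using ex_has_least_nat[of ext V card] by metis
  define L where "L = Q - P"
  have QPL: "P \<union> L = Q" and PL: "P \<inter> L = {}" and LV: "L \<subseteq> V" and "L \<noteq> {}" and Qc: "pred_closed E Q"
    and finQ: "finite Q"
    using Q(1) finite_V finite_subset unfolding ext_def L_def by auto
  let ?EL = "{(u, v, s) \<in> E. u \<in> L \<and> v \<in> L}"
  have strong: "\<exists>s. walk ?EL u v s" if uv: "u \<in> L" "v \<in> L" for u v
  proof -
    \<comment> \<open>The vertices of \<open>L\<close> that reach \<open>v\<close> inside
      \<open>L\<close> form, with \<open>P\<close>, a set again closed under predecessors;
      minimality of \<open>Q\<close> makes it all of \<open>Q\<close>.\<close>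
    let ?R = "P \<union> {u \<in> L. \<exists>s. walk ?EL u v s}"
    have "v \<in> ?R" using uv(2) walk_refl[of ?EL v] by blast
    have "p \<in> ?R" if pq: "(p, q, s) \<in> E" "q \<in> ?R" for p q s
    proof (cases "p \<in> P")
      case False
      then have "q \<notin> P" using pq(1) Pc unfolding pred_closed_def by blast
      then obtain r where q: "q \<in> L" "walk ?EL q v r" using pq(2) by blast
      then have "p \<in> Q" using pq(1) Qc QPL unfolding pred_closed_def by blast
      then have "p \<in> L" using False unfolding L_def by blast
      then have "(p, q, s) \<in> ?EL" using pq(1) q(1) by blast
      then have "walk ?EL p v (s * r)" by (rule walk_trans[OF q(2) walk_arc])
      then show ?thesis using \<open>p \<in> L\<close> by blast
    qed blast
    then have "pred_closed E ?R" unfolding pred_closed_def by blast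
    moreover have "?R \<subseteq> Q" "P \<subset> ?R" using QPL \<open>v \<in> ?R\<close> uv(2) PL by auto
    moreover have "Q \<subseteq> V" using Q(1) unfolding ext_def by blast
    ultimately have "ext ?R" unfolding ext_def by blast
    then have "?R = Q" using Q(2) finQ \<open>?R \<subseteq> Q\<close> by (intro card_seteq)
    then show ?thesis using uv(1) PL QPL by auto
  qed
  have EL: "?EL \<subseteq> L \<times> L \<times> {-1, 1}" using E unfolding signed_digraph_def by auto
  have uniqL: "\<exists>\<^sub>\<le>\<^sub>1C. negative_cycle ?EL C"
    by (rule Uniq_I) (use uniq negative_cycle_mono[of ?EL _ E] in \<open>auto dest: Uniq_D\<close>)
  obtain j \<sigma> where j: "j \<in> L" and bal: "balanced \<sigma> {(u, v, s) \<in> ?EL. v \<noteq> j}"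
    using balanced_off_vertex[OF EL strong \<open>L \<noteq> {}\<close> uniqL] by blast
  interpret network_layer V E f P L j
    by unfold_locales (use Pc Qc QPL PL LV j in auto)
  have "{(u, v, s) \<in> ?EL. v \<noteq> j} = layer_arcs" by auto
  then have "\<exists>a\<in>A. \<exists>b\<in>B. agree (P \<union> L) a b"
    using attractors_agree_on_layer[OF _ A B ab xA xB] bal by auto
  then have "good Q" using Q(1) QPL unfolding good_def ext_def by auto
  then have "card Q \<le> card P" using P(2) by blast
  moreover have "card P < card Q" using Q(1) finQ psubset_card_mono unfolding ext_def by blast
  ultimately show False by simp
qed

lemma trapping_graph_if_unique_negative_cycle:
  assumes E: "signed_digraph V E" and uniq: "\<exists>\<^sub>\<le>\<^sub>1C. negative_cycle E C"
    and sc: "strongly_connected V E"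
  shows "trapping_graph V \<Gamma>"
  unfolding trapping_graph_def
proof (intro conjI allI impI)
  show "separating_graph V \<Gamma>" by (rule separating_graph_if_unique_negative_cycle[OF E uniq])
next
  fix A assume A: "attractor V \<Gamma> A"
  then have ne: "A \<noteq> {}" and AV: "A \<subseteq> configs V" unfolding attractor_def trap_set_def by auto
  have \<Gamma>V: "\<Gamma> \<subseteq> configs V \<times> configs V" using flip_in_configs unfolding async_graph_def by auto
  let ?H = "subspace_hull V A"
  note H = smallest_subspace[OF ne AV]
  obtain I c where I: "I \<subseteq> V" and HI: "?H = {x \<in> configs V. \<forall>i\<in>I. x i = c i}"
    using H(1) unfolding config_subspace_def by blast
  \<comment> \<open>This makes the hull a trap set: no update in it touches a coordinate of
    \<open>I\<close>.\<close>
  have "f x i = c i" if x: "x \<in> ?H" and i: "i \<in> I" for x i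
  proof -
    have "V \<noteq> {}" and iV: "i \<in> V" using i I by auto
    have strong: "\<exists>s. walk E u v s" if uv: "u \<in> V" "v \<in> V" for u v
    proof -
      have "(u, v) \<in> {(arc_tail a, arc_head a) | a. a \<in> E}\<^sup>*" using sc uv unfolding strongly_connected_def by blast
      then show ?thesis
      proof (induction rule: rtrancl_induct)
        case base
        show ?case using walk_refl[of E u] by blast
      next
        case (step y z)
        then obtain s t where "walk E u y s" "(y, z, t) \<in> E"
          unfolding arc_tail_def arc_head_def by (auto simp: prod_eq_iff)
        then show ?case by (blast intro: walk_step)
      qed
    qed
    have "E \<subseteq> V \<times> V \<times> {-1, 1}" using E unfolding signed_digraph_def by blast
    then obtain j \<sigma> where j: "j \<in> V" and bal: "balanced \<sigma> {(u, v, s) \<in> E. v \<noteq> j}"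
      using balanced_off_vertex[OF _ strong \<open>V \<noteq> {}\<close> uniq] by blast
    interpret network_layer V E f "{}" V j
      by unfold_locales (use j arcs_in_V in \<open>auto simp: pred_closed_def\<close>)
    have "{(u, v, s) \<in> E. v \<noteq> j} = layer_arcs" using arcs_in_V by auto
    then have bal: "balanced \<sigma> layer_arcs" using bal by simp
    obtain y where y: "y \<in> A" "\<And>w. w \<in> A \<Longrightarrow> below V (\<lambda>i. \<not> \<sigma> i) w y"
      using attractor_top[OF balanced_uminus[OF bal] A] by blast
    obtain z where z: "z \<in> A" "\<And>w. w \<in> A \<Longrightarrow> below V \<sigma> w z"
      using attractor_top[OF bal A] by blast
    have ci: "w k = c k" if "w \<in> A" "k \<in> I" for w k using that H(2) HI by auto
    have fA: "f w k = c k" if w: "w \<in> A" "k \<in> I" for w k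
    proof (rule ccontr)
      assume "f w k \<noteq> c k"
      then have "flip w k \<in> A" using attractor_flip[OF A w(1)] ci[OF w] w I by auto
      then have "flip w k k = c k" using ci w(2) by blast
      then show False using ci[OF w] by (simp add: flip_def)
    qed
    show ?thesis
    proof (cases "i = j")
      \<comment> \<open>\<open>x\<close> lies between the bottom \<open>y\<close> and the top
        \<open>z\<close> of \<open>A\<close>, where \<open>f\<close> takes the value
        \<open>c i\<close> at \<open>i\<close>; monotonicity forces this value at
        \<open>x\<close>.\<close>
      case False
      have xV: "x \<in> configs V" using x HI by blast
      have vals: "\<exists>a\<in>A. a k = x k" if "k \<in> V" for k using subspace_hull_value[OF ne AV x that] .
      have xz: "below V \<sigma> x z" using vals z(2) unfolding below_def by metis
      have xy: "below V (\<lambda>i. \<not> \<sigma> i) x y" using vals y(2) unfolding below_def by metis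
      have "f z i = \<sigma> i" if "f x i = \<sigma> i"
        by (rule local_mono[OF PL_closed L_V bal xV attractor_configs[OF A z(1)] _ xz iV False that])
          (simp add: agree_def)
      moreover have "f y i = (\<not> \<sigma> i)" if "f x i = (\<not> \<sigma> i)"
        by (rule local_mono[OF PL_closed L_V balanced_uminus[OF bal] xV
              attractor_configs[OF A y(1)] _ xy iV False that])
          (simp add: agree_def)
      ultimately show ?thesis using fA[OF z(1) i] fA[OF y(1) i] by auto
    next
      case True
      txt \<open>If \<open>j\<close> is frozen on \<open>A\<close>, the network is monotone there, and climbing from the
        bottom of \<open>A\<close> ends in a fixed point.\<close>
      define up where "up w \<longleftrightarrow> w \<in> A \<and> (\<forall>k\<in>V. k \<noteq> j \<longrightarrow> w k = \<sigma> k \<longrightarrow> f w k = \<sigma> k)" for w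
      define m where "m w = card {k\<in>V. w k = \<sigma> k}" for w
      have "up y"
        unfolding up_def
      proof (intro conjI ballI impI)
        fix k assume k: "k \<in> V" "k \<noteq> j" "y k = \<sigma> k"
        show "f y k = \<sigma> k"
        proof (rule ccontr)
          assume "f y k \<noteq> \<sigma> k"
          then have "flip y k \<in> A" using attractor_flip[OF A y(1) k(1)] k by auto
          then show False using y(2) k unfolding below_def by (auto simp: flip_def)
        qed
      qed (rule y(1))
      moreover have "m w < Suc (card V)" for w
        unfolding m_def less_Suc_eq_le using finite_V by (auto intro: card_mono)
      ultimately obtain w where w: "up w" "\<And>w'. up w' \<Longrightarrow> m w' \<le> m w"
        using ex_has_greatest_nat[of up y m "Suc (card V)"] by blast
      have wA: "w \<in> A" using w(1) unfolding up_def by blast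
      \<comment> \<open>An update of \<open>w\<close> would move \<open>k\<close> up to
        \<open>\<sigma> k\<close> and preserve \<open>up\<close> by monotonicity, against the
        maximal count. It cannot concern \<open>j\<close>, because \<open>j = i\<close> is
        frozen.\<close>
      have fixed: "f w k = w k" if k: "k \<in> V" for k
      proof (rule ccontr)
        assume nf: "f w k \<noteq> w k"
        have w': "flip w k \<in> A" using attractor_flip[OF A wA k nf] .
        have kj: "k \<noteq> j" using nf True fA[OF wA i] ci[OF wA i] by auto
        have wk: "w k \<noteq> \<sigma> k" "f w k = \<sigma> k" using nf w(1) k kj unfolding up_def by auto
        have "below V \<sigma> w (flip w k)" using wk unfolding below_def flip_def by auto
        then have mono: "f (flip w k) l = \<sigma> l" if "l \<in> V" "l \<noteq> j" "f w l = \<sigma> l" for l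
          by (intro local_mono[OF PL_closed L_V bal attractor_configs[OF A wA]
                attractor_configs[OF A w']]) (use that in \<open>auto simp: agree_def\<close>)
        have "up (flip w k)"
          unfolding up_def
        proof (intro conjI ballI impI)
          fix l assume l: "l \<in> V" "l \<noteq> j" "flip w k l = \<sigma> l"
          then have "f w l = \<sigma> l" using w(1) wk unfolding up_def flip_def by (auto split: if_splits)
          then show "f (flip w k) l = \<sigma> l" using mono l by blast
        qed (rule w')
        then have "m (flip w k) \<le> m w" using w(2) by blast
        moreover have "{l\<in>V. flip w k l = \<sigma> l} = insert k {l\<in>V. w l = \<sigma> l}"
          using wk k by (auto simp: flip_def)
        ultimately show False using wk finite_V unfolding m_def by simp
      qed
      \<comment> \<open>A fixed point is a one-element trap set, so \<open>A\<close> and its hull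
        reduce to \<open>w\<close>.\<close>
      have "{w} = A" by (rule attractor_minimal[OF A]) (use wA fixed in auto)
      then have "x k = w k" if "k \<in> V" for k using subspace_hull_value[OF ne AV x that] by auto
      then have "x = w" using configs_eqI attractor_configs[OF A wA] x HI unfolding agree_def by blast
      then show ?thesis using fA[OF wA i] by simp
    qed
  qed
  note frozen = this
  have "trap_set V \<Gamma> ?H"
  proof (rule trap_setI)
    show "?H \<subseteq> configs V" unfolding HI by blast
  next
    fix x i assume x: "x \<in> ?H" and i: "i \<in> V" "f x i \<noteq> x i"
    have "x k = c k" if "k \<in> I" for k using x that unfolding HI by blast
    then have "i \<notin> I" using frozen[OF x, of i] i(2) by metis
    moreover have "flip x i \<in> configs V" by (rule flip_in_configs) (use x i(1) HI in auto)
    ultimately show "flip x i \<in> ?H" using x unfolding HI by (auto simp: flip_def)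
  qed
  then have "trap_space V \<Gamma> ?H" using H(1) unfolding trap_space_def by blast
  then have "trap_space_hull V \<Gamma> A \<subseteq> ?H" using smallest_trap_space(3)[OF ne AV \<Gamma>V] H(2) by blast
  moreover have "?H \<subseteq> trap_space_hull V \<Gamma> A"
    using smallest_trap_space(1,2)[OF ne AV \<Gamma>V] H(3) unfolding trap_space_def by blast
  ultimately show "?H = trap_space_hull V \<Gamma> A" by blast
qed

end

theorem theorem33:
  fixes V :: "'a set" and E :: "'a arc set"
  assumes "signed_digraph V E"
  shows "((\<exists>\<^sub>\<le>\<^sub>1C. negative_cycle E C) \<longrightarrow> separating V E) \<and>
    (strongly_connected V E \<and> (\<exists>\<^sub>\<le>\<^sub>1C. negative_cycle E C) \<longrightarrow> trapping V E)"
proof -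
  have net: "network V E f" if "f \<in> networks_on V E" for f
    using that assms unfolding signed_digraph_def by unfold_locales auto
  show ?thesis
    unfolding separating_def trapping_def
    using network.separating_graph_if_unique_negative_cycle[OF net assms]
      network.trapping_graph_if_unique_negative_cycle[OF net assms] by blast
qed

end
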